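(* Let $1\le p<\infty$. Then for every $q$ with $p<q<\infty$, the spaces $\ell^p_{q,p}(\mathbb Z)$ and $\ell^p(\mathbb Z)$ coincide as sets and their norms are equivalent.
   Context: For $j\in\mathbb N_0=\{0,1,2,\dots\}$ and $k\in\mathbb Z$ let $I(j,k)=[2^jk,2^j(k+1))\cap\mathbb Z$ (a discrete dyadic interval with $2^j$ elements). For $1\le p<q<\infty$, $1\le r<\infty$ and a real sequence $x=(x(k))_{k\in\mathbb Z}$ put $$\|x\|_{\ell^p_{q,r}}=\Big(\sum_{j=0}^\infty\sum_{k\in\mathbb Z}(2^j)^{r(\frac1q-\frac1p)}\Big(\sum_{l\in I(j,k)}|x(l)|^p\Big)^{r/p}\Big)^{1/r},$$ and let $\ell^p_{q,r}(\mathbb Z)$ be the space of all $x\in\mathbb R^{\mathbb Z}$ with $\|x\|_{\ell^p_{q,r}}<\infty$. The space $\ell^p_{q,p}(\mathbb Z)$ is the case $r=p$. *)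

theory Defs
  imports "HOL-Analysis.Analysis"
begin

definition dyadic_interval :: "nat \<Rightarrow> int \<Rightarrow> int set" where
  "dyadic_interval j k = {2 ^ j * k ..< 2 ^ j * (k + 1)}"

text \<open>
  Real powers of extended nonnegative numbers, so that a divergent sum gives the norm \<open>top\<close>.
  Meant for exponents \<open>a > 0\<close>; then \<open>top\<close> to the power \<open>a\<close> is \<open>top\<close>
  and \<open>0\<close> to the power \<open>a\<close> is \<open>0\<close>.
\<close>
definition ennpowr :: "ennreal \<Rightarrow> real \<Rightarrow> ennreal" where
  "ennpowr s a = (if s = top then top else ennreal (enn2real s powr a))"

definition lp_norm :: "real \<Rightarrow> (int \<Rightarrow> real) \<Rightarrow> ennreal" where
  "lp_norm p x = ennpowr (\<Sum>\<^sub>\<infinity>k\<in>UNIV. ennreal (\<bar>x k\<bar> powr p)) (1 / p)"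

definition lp_space :: "real \<Rightarrow> (int \<Rightarrow> real) set" where
  "lp_space p = {x. lp_norm p x < top}"

definition bm_norm :: "real \<Rightarrow> real \<Rightarrow> real \<Rightarrow> (int \<Rightarrow> real) \<Rightarrow> ennreal" where
  "bm_norm p q r x =
     ennpowr
       (\<Sum>j. \<Sum>\<^sub>\<infinity>k\<in>UNIV.
          ennreal ((2 ^ j) powr (r * (1 / q - 1 / p)) *
                   (\<Sum>l\<in>dyadic_interval j k. \<bar>x l\<bar> powr p) powr (r / p)))
       (1 / r)"

definition bm_space :: "real \<Rightarrow> real \<Rightarrow> real \<Rightarrow> (int \<Rightarrow> real) set" where
  "bm_space p q r = {x. bm_norm p q r x < top}"

definition equivalent_norms_on :: "'v set \<Rightarrow> ('v \<Rightarrow> ennreal) \<Rightarrow> ('v \<Rightarrow> ennreal) \<Rightarrow> bool" where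
  "equivalent_norms_on V N M \<longleftrightarrow>
     (\<exists>c C :: real. c > 0 \<and> C > 0 \<and>
        (\<forall>x\<in>V. ennreal c * M x \<le> N x \<and> N x \<le> ennreal C * M x))"

end

theory Submission
  imports Defs
begin

text \<open>
  In the diagonal case \<open>r = p\<close> the outer exponent \<open>r / p\<close> is \<open>1\<close>, so no power is taken
  of the block sums.  For a fixed scale \<open>j\<close> the dyadic intervals partition the integers, and the
  blocks of that scale therefore contribute the full sum
  \<open>S = \<Sum>k. \<bar>x k\<bar> powr p\<close>, independently of \<open>j\<close>, weighted by
  \<open>(2 ^ j) powr (p / q - 1)\<close>.  The weights form a geometric sequence with ratio
  \<open>\<theta> = 2 powr (p / q - 1)\<close>, and \<open>\<theta> < 1\<close> is precisely the hypothesis \<open>p < q\<close>.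
  Summing over the scales gives
  \<open>S / (1 - \<theta>)\<close> for the \<open>p\<close>-th power of the norm,
  so the two norms are equal up to the constant factor
  \<open>(1 / (1 - \<theta>)) powr (1 / p)\<close> (lemma \<open>bm_norm_eq_lp_norm\<close>), also where they are infinite.
  Both claims of the theorem follow from this identity.  Working in the extended nonnegative reals
  makes every rearrangement of sums unconditional.
\<close>

text \<open>
  Multiplication of extended nonnegative reals is not continuous at \<open>(0, \<infinity>)\<close>, so the
  general rules for infinite sums in topological semirings do not apply; the supremum description
  of a nonnegative sum does not need continuity.
\<close>
lemma infsum_cmult_ennreal:
  fixes f :: "'a \<Rightarrow> ennreal"
  shows "(\<Sum>\<^sub>\<infinity>x\<in>A. c * f x) = c * (\<Sum>\<^sub>\<infinity>x\<in>A. f x)"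
  by (simp add: nonneg_infsum_complete sum_distrib_left[symmetric] SUP_mult_left_ennreal)

text \<open>
  Both sides are suprema over finite index sets.  A finite set \<open>F\<close> of values collects the terms
  over the finite set \<open>g -` F\<close>, and such preimages are cofinal among the finite subsets of the
  domain, since a finite \<open>G\<close> is contained in \<open>g -` (g ` G)\<close>.
\<close>
lemma infsum_sum_fibres_ennreal:
  fixes f :: "'a \<Rightarrow> ennreal" and g :: "'a \<Rightarrow> 'b"
  assumes fin: "\<And>y. finite (g -` {y})"
  shows "(\<Sum>\<^sub>\<infinity>y\<in>UNIV. \<Sum>x\<in>g -` {y}. f x) = (\<Sum>\<^sub>\<infinity>x\<in>UNIV. f x)"
proof -
  have fin_vimage: "finite (g -` F)" if "finite F" for F
  proof -
    have "g -` F = (\<Union>y\<in>F. g -` {y})"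
      by auto
    then show ?thesis
      using that fin by simp
  qed
  have group: "(\<Sum>y\<in>F. \<Sum>x\<in>g -` {y}. f x) = sum f (g -` F)" if "finite F" for F
  proof -
    have "(\<Sum>y\<in>F. \<Sum>x\<in>g -` {y}. f x) = (\<Sum>y\<in>F. \<Sum>x\<in>{x \<in> g -` F. g x = y}. f x)"
      by (intro sum.cong) auto
    also have "\<dots> = sum f (g -` F)"
      using that fin_vimage by (intro sum.group) auto
    finally show ?thesis .
  qed
  have "(SUP F\<in>{F. finite F}. sum f (g -` F)) = (SUP G\<in>{G. finite G}. sum f G)"
  proof (rule SUP_eq)
    show "\<exists>G\<in>{G. finite G}. sum f (g -` F) \<le> sum f G" if "F \<in> {F. finite F}" for F
      using that fin_vimage by blast
    show "\<exists>F\<in>{F. finite F}. sum f G \<le> sum f (g -` F)" if "G \<in> {G. finite G}" for G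
      using that by (intro bexI[of _ "g ` G"] sum_mono2 fin_vimage) auto
  qed
  then show ?thesis
    by (simp add: nonneg_infsum_complete group cong: SUP_cong_simp)
qed

lemma dyadic_interval_eq_fibre: "dyadic_interval j k = (\<lambda>l. l div 2 ^ j) -` {k}"
proof -
  have pos: "(2::int) ^ j > 0"
    by simp
  have "l div 2 ^ j = k" if "2 ^ j * k \<le> l" "l < 2 ^ j * k + 2 ^ j" for l :: int
    by (rule int_div_pos_eq[of _ _ _ "l - 2 ^ j * k"]) (use that in auto)
  moreover have "2 ^ j * (l div 2 ^ j) \<le> l \<and> l < 2 ^ j * (l div 2 ^ j) + 2 ^ j" for l :: int
    using pos_mod_bound[OF pos, of l] pos_mod_sign[OF pos, of l] mult_div_mod_eq[of "2 ^ j" l]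
    by linarith
  ultimately have "2 ^ j * k \<le> l \<and> l < 2 ^ j * k + 2 ^ j \<longleftrightarrow> l div 2 ^ j = k" for l :: int
    by blast
  then show ?thesis
    by (simp add: dyadic_interval_def distrib_left set_eq_iff)
qed

text \<open>
  The dyadic intervals of one scale partition the integers, because they are the fibres of
  \<open>l \<mapsto> l div 2 ^ j\<close>.
\<close>
lemma infsum_sum_dyadic_interval:
  fixes f :: "int \<Rightarrow> ennreal"
  shows "(\<Sum>\<^sub>\<infinity>k\<in>UNIV. \<Sum>l\<in>dyadic_interval j k. f l) = (\<Sum>\<^sub>\<infinity>l\<in>UNIV. f l)"
proof -
  have "finite ((\<lambda>l::int. l div 2 ^ j) -` {k})" for k
    by (simp flip: dyadic_interval_eq_fibre add: dyadic_interval_def)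
  then show ?thesis
    unfolding dyadic_interval_eq_fibre by (rule infsum_sum_fibres_ennreal)
qed

lemma ennpowr_mult_ennreal:
  assumes "0 < K"
  shows "ennpowr (ennreal K * s) a = ennreal (K powr a) * ennpowr s a"
  using assms
  by (auto simp: ennpowr_def ennreal_mult_eq_top_iff ennreal_mult_top enn2real_mult powr_mult
      ennreal_mult)

lemma suminf_ennreal_geometric:
  assumes "0 \<le> \<theta>" "\<theta> < 1"
  shows "(\<Sum>j. ennreal (\<theta> ^ j)) = ennreal (1 / (1 - \<theta>))"
  using assms by (intro suminf_ennreal_eq geometric_sums) auto

lemma bm_norm_eq_lp_norm:
  assumes "0 < p" "p < q"
  shows "bm_norm p q p x = ennreal ((1 / (1 - 2 powr (p / q - 1))) powr (1 / p)) * lp_norm p x"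
proof -
  define \<theta> :: real where "\<theta> = 2 powr (p / q - 1)"
  let ?S = "\<Sum>\<^sub>\<infinity>k\<in>UNIV. ennreal (\<bar>x k\<bar> powr p)"
  have \<theta>: "0 \<le> \<theta>" "\<theta> < 1"
    using assms by (auto simp: \<theta>_def powr_less_one)
  have weight: "(2 ^ j) powr (p * (1 / q - 1 / p)) = \<theta> ^ j" for j
  proof -
    have "p * (1 / q - 1 / p) = p / q - 1"
      using assms by (simp add: field_simps)
    then show ?thesis
      by (simp add: \<theta>_def powr_realpow[symmetric] powr_powr mult.commute)
  qed
  have scale: "(\<Sum>\<^sub>\<infinity>k\<in>UNIV. ennreal ((2 ^ j) powr (p * (1 / q - 1 / p)) *
      (\<Sum>l\<in>dyadic_interval j k. \<bar>x l\<bar> powr p) powr (p / p)))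
    = ennreal (\<theta> ^ j) * ?S" for j
  proof -
    have "ennreal ((2 ^ j) powr (p * (1 / q - 1 / p)) *
        (\<Sum>l\<in>dyadic_interval j k. \<bar>x l\<bar> powr p) powr (p / p))
      = ennreal (\<theta> ^ j) * (\<Sum>l\<in>dyadic_interval j k. ennreal (\<bar>x l\<bar> powr p))" for k
      using assms \<theta> by (simp add: weight ennreal_mult sum_nonneg)
    then show ?thesis
      by (simp only: infsum_cmult_ennreal infsum_sum_dyadic_interval)
  qed
  have "bm_norm p q p x = ennpowr ((\<Sum>j. ennreal (\<theta> ^ j)) * ?S) (1 / p)"
    unfolding bm_norm_def scale by simp
  also have "\<dots> = ennpowr (ennreal (1 / (1 - \<theta>)) * ?S) (1 / p)"
    by (simp only: suminf_ennreal_geometric \<theta>)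
  also have "\<dots> = ennreal ((1 / (1 - \<theta>)) powr (1 / p)) * lp_norm p x"
    unfolding lp_norm_def using \<theta> by (intro ennpowr_mult_ennreal) simp
  finally show ?thesis
    by (simp add: \<theta>_def)
qed

theorem theorem2p3:
  fixes p q :: real
  assumes "1 \<le> p" and "p < q"
  shows "bm_space p q p = lp_space p
    \<and> equivalent_norms_on (lp_space p) (bm_norm p q p) (lp_norm p)"
proof -
  define c where "c = (1 / (1 - 2 powr (p / q - 1))) powr (1 / p)"
  have norm_eq: "bm_norm p q p x = ennreal c * lp_norm p x" for x
    unfolding c_def using assms by (intro bm_norm_eq_lp_norm) auto
  have "c > 0"
    using assms by (auto simp: c_def)
  then have "bm_space p q p = lp_space p"
    by (auto simp: bm_space_def lp_space_def norm_eq ennreal_mult_less_top)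
  moreover have "equivalent_norms_on (lp_space p) (bm_norm p q p) (lp_norm p)"
    unfolding equivalent_norms_on_def norm_eq using \<open>c > 0\<close> by blast
  ultimately show ?thesis
    by blast
qed

end
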